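(* Let $\Delta$ be a connectivity complex with vertex set $V=\{1,\ldots,N_V\}$. Then the set $\mathcal{M}_0(\Delta)$ of admissible meshes with connectivity $\Delta$ is an open (possibly empty) subset of $\mathbb{R}^{2\times N_V}$.
   Context: An abstract simplicial complex $\Delta$ over a finite set is a non-empty collection of non-empty subsets such that every non-empty subset of an element of $\Delta$ is in $\Delta$. Elements $\sigma\in\Delta$ are faces; $\sigma$ is an $m$-face if $\#\sigma=m+1$; the vertex set of $\Delta$ is the union of its faces. $\Delta$ is a simplicial $2$-complex if the largest dimension of its faces is $2$. It is pure if every maximal face (w.r.t. inclusion) has dimension $2$. It is $2$-path connected if for any two distinct $2$-faces $\sigma,\sigma'$ there is a finite sequence of $2$-faces $\sigma_0=\sigma,\ldots,\sigma_n=\sigma'$ such that $\sigma_i\cap\sigma_{i+1}$ is a $1$-face for $i=0,\ldots,n-1$. A connectivity complex is an abstract simplicial $2$-complex which is pure and $2$-path connected. A simplex of dimension $k$ in $\mathbb{R}^2$ is the convex hull of $k+1$ affine independent points; its faces are the convex hulls of non-empty subsets of these points. A geometric simplicial complex in $\mathbb{R}^2$ is a non-empty finite set of simplices such that every face of a simplex in the set is in the set, and the non-empty intersection of any two simplices in the set is a face of both. For $Q=[Q_1,\ldots,Q_{N_V}]\in\mathbb{R}^{2\times N_V}$ with columns $Q_i\in\mathbb{R}^2$ (vertex positions), let $\Sigma_\Delta(Q)=\{\operatorname{conv}\{Q_{i_0},\ldots,Q_{i_k}\} : \{i_0,\ldots,i_k\}\in\Delta\}$. If $\Sigma_\Delta(Q)$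 is a geometric simplicial complex, its associated abstract simplicial complex is $\{\sigma\subset\{1,\ldots,N_V\} : \operatorname{conv}\{Q_i\}_{i\in\sigma}\in\Sigma_\Delta(Q)\}$. Define $\mathcal{M}_0(\Delta)$ as the set of all $Q\in\mathbb{R}^{2\times N_V}$ such that $\Sigma_\Delta(Q)$ is a geometric simplicial complex in $\mathbb{R}^2$ whose associated abstract simplicial complex is $\Delta$. (In particular, for $Q\in\mathcal{M}_0(\Delta)$ the points $Q_{i_0},Q_{i_1},Q_{i_2}$ are affine independent for every $\{i_0,i_1,i_2\}\in\Delta$.)
   Formalization: M_0(Δ) is taken with the explicit requirement that the vertex positions of every face of Δ are affine independent; the paper presents this as a consequence, but the displayed definition also admits degenerate meshes (e.g. a triangle with Q_1=Q_2), for which openness fails. *)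

theory Defs
  imports "HOL-Analysis.Analysis"
begin

definition abstract_simplicial_complex :: "'a set set \<Rightarrow> bool" where
  "abstract_simplicial_complex \<Delta> \<longleftrightarrow>
     finite (\<Union>\<Delta>) \<and> \<Delta> \<noteq> {} \<and> {} \<notin> \<Delta> \<and>
     (\<forall>\<sigma>\<in>\<Delta>. \<forall>\<tau>. \<tau> \<subseteq> \<sigma> \<and> \<tau> \<noteq> {} \<longrightarrow> \<tau> \<in> \<Delta>)"

definition m_face :: "'a set set \<Rightarrow> nat \<Rightarrow> 'a set \<Rightarrow> bool" where
  "m_face \<Delta> m \<sigma> \<longleftrightarrow> \<sigma> \<in> \<Delta> \<and> card \<sigma> = m + 1"

definition vertex_set :: "'a set set \<Rightarrow> 'a set" where
  "vertex_set \<Delta> = \<Union>\<Delta>"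

definition simplicial_2_complex :: "'a set set \<Rightarrow> bool" where
  "simplicial_2_complex \<Delta> \<longleftrightarrow>
     abstract_simplicial_complex \<Delta> \<and>
     (\<exists>\<sigma>. m_face \<Delta> 2 \<sigma>) \<and> (\<forall>m \<sigma>. m_face \<Delta> m \<sigma> \<longrightarrow> m \<le> 2)"

definition pure_2 :: "'a set set \<Rightarrow> bool" where
  "pure_2 \<Delta> \<longleftrightarrow>
     (\<forall>\<sigma>\<in>\<Delta>. (\<forall>\<tau>\<in>\<Delta>. \<sigma> \<subseteq> \<tau> \<longrightarrow> \<tau> = \<sigma>) \<longrightarrow> m_face \<Delta> 2 \<sigma>)"

definition path_connected_2 :: "'a set set \<Rightarrow> bool" where
  "path_connected_2 \<Delta> \<longleftrightarrow>
     (\<forall>\<sigma> \<sigma>'. m_face \<Delta> 2 \<sigma> \<and> m_face \<Delta> 2 \<sigma>' \<and> \<sigma> \<noteq> \<sigma>' \<longrightarrow>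
        (\<exists>(n::nat) s. s 0 = \<sigma> \<and> s n = \<sigma>' \<and>
           (\<forall>i\<le>n. m_face \<Delta> 2 (s i)) \<and>
           (\<forall>i<n. m_face \<Delta> 1 (s i \<inter> s (Suc i)))))"

definition connectivity_complex :: "'a set set \<Rightarrow> bool" where
  "connectivity_complex \<Delta> \<longleftrightarrow>
     simplicial_2_complex \<Delta> \<and> pure_2 \<Delta> \<and> path_connected_2 \<Delta>"

definition simplex_face :: "'b::euclidean_space set \<Rightarrow> 'b set \<Rightarrow> bool" where
  "simplex_face F S \<longleftrightarrow>
     (\<exists>C C'. \<not> affine_dependent C \<and> S = convex hull C \<and>
             C' \<subseteq> C \<and> C' \<noteq> {} \<and> F = convex hull C')"

(* Not the library's simplicial_complex: that one counts the empty set as a simplex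
   of dimension -1 and as a face of every simplex. *)
definition geometric_simplicial_complex :: "'b::euclidean_space set set \<Rightarrow> bool" where
  "geometric_simplicial_complex K \<longleftrightarrow>
     K \<noteq> {} \<and> finite K \<and>
     (\<forall>S\<in>K. \<exists>k::nat. int k simplex S) \<and>
     (\<forall>S\<in>K. \<forall>F. simplex_face F S \<longrightarrow> F \<in> K) \<and>
     (\<forall>S\<in>K. \<forall>T\<in>K. S \<inter> T \<noteq> {} \<longrightarrow> simplex_face (S \<inter> T) S \<and> simplex_face (S \<inter> T) T)"

(* The vertices 1, ..., N_V are the elements of the finite type 'v, with N_V = CARD('v);
   real ^ 'v ^ 2 is the space of real 2 x N_V matrices, and column i Q is the
   position of vertex i. *)
definition hull_of :: "real ^ 'v ^ 2 \<Rightarrow> 'v set \<Rightarrow> (real ^ 2) set" where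
  "hull_of Q \<sigma> = convex hull ((\<lambda>i. column i Q) ` \<sigma>)"

definition Sigma_complex :: "'v set set \<Rightarrow> real ^ 'v ^ 2 \<Rightarrow> (real ^ 2) set set" where
  "Sigma_complex \<Delta> Q = {hull_of Q \<sigma> | \<sigma>. \<sigma> \<in> \<Delta>}"

definition associated_complex :: "(real ^ 2) set set \<Rightarrow> real ^ 'v ^ 2 \<Rightarrow> 'v set set" where
  "associated_complex K Q = {\<sigma>. hull_of Q \<sigma> \<in> K}"

definition affine_independent_points :: "real ^ 'v ^ 2 \<Rightarrow> 'v set \<Rightarrow> bool" where
  "affine_independent_points Q \<sigma> \<longleftrightarrow>
     inj_on (\<lambda>i. column i Q) \<sigma> \<and> \<not> affine_dependent ((\<lambda>i. column i Q) ` \<sigma>)"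

(* A k-face {i_0, ..., i_k} has to be realised as a simplex of dimension k, i.e. by k+1
   affine independent points. As Sigma_complex is a set of point sets, it does not record
   this: for the full triangle on {1,2,3} with Q_1 = Q_2 distinct from Q_3, it is the
   complex of the segment from Q_1 to Q_3, and its associated complex is again the full
   triangle. Hence the explicit first conjunct. *)
definition M0 :: "'v::finite set set \<Rightarrow> (real ^ 'v ^ 2) set" where
  "M0 \<Delta> = {Q. (\<forall>\<sigma>\<in>\<Delta>. affine_independent_points Q \<sigma>) \<and>
               geometric_simplicial_complex (Sigma_complex \<Delta> Q) \<and>
               associated_complex (Sigma_complex \<Delta> Q) Q = \<Delta>}"

end

theory Submission
  imports Defs
begin

text \<open>
  The idea is to describe \<open>M0 \<Delta>\<close> by conditions that are visibly open: a mesh \<open>Q\<close> is admissible if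
  and only if any two faces of \<open>\<Delta>\<close> without a common vertex are realised by disjoint sets
  (\<open>M0_eq_disjoint_hulls\<close>). For a single pair of faces, this condition is open. The two hulls are
  compact and convex, so if they are disjoint, some line strictly separates them; the same line
  still separates the finitely many vertices, hence the hulls, after a small perturbation
  (\<open>open_disjoint_hulls\<close>). As there are only finitely many pairs of faces, \<open>M0 \<Delta>\<close> is open.

  That the disjointness conditions suffice is an argument in the style of Radon's theorem. If a
  point has two different representations as a convex combination, over the vertices of two faces
  \<open>\<sigma>\<close> and \<open>\<tau>\<close>, subtract the coefficients and separate the positive from the negative differences.
  After normalisation this is a common point of the hulls of two disjoint sets of vertices, one
  inside \<open>\<sigma>\<close> and the other inside \<open>\<tau>\<close>. So disjointness for all pairs of faces without a common
  vertex forces both affine independence (take \<open>\<sigma> = \<tau>\<close>, which is Radon's theorem itself) and the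
  equality of the intersection of two hulls with the hull of the common vertices
  (\<open>convex_hull_Int_if_disjoint_subsets\<close>).
\<close>

section \<open>Convex hulls of finite sets of points\<close>

text \<open>
  The Radon-style step: the coefficients \<open>u\<close> and \<open>w\<close> of two representations of the same point can
  differ only if the positive and the negative part of \<open>u - w\<close> yield a forbidden common point. If
  they agree, they vanish outside \<open>A \<inter> B\<close>.
\<close>
lemma convex_hull_Int_if_disjoint_subsets:
  fixes A B :: "'a::real_vector set"
  assumes fin: "finite A" "finite B"
    and disj: "\<And>A' B'. A' \<subseteq> A \<Longrightarrow> B' \<subseteq> B \<Longrightarrow> A' \<inter> B' = {} \<Longrightarrow>
      convex hull A' \<inter> convex hull B' = {}"
  shows "convex hull A \<inter> convex hull B = convex hull (A \<inter> B)"
proof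
  show "convex hull (A \<inter> B) \<subseteq> convex hull A \<inter> convex hull B"
    by (simp add: hull_mono)
  show "convex hull A \<inter> convex hull B \<subseteq> convex hull (A \<inter> B)"
  proof
    fix p assume p: "p \<in> convex hull A \<inter> convex hull B"
    obtain u0 where u0: "\<forall>x\<in>A. 0 \<le> u0 x" "sum u0 A = 1" "(\<Sum>x\<in>A. u0 x *\<^sub>R x) = p"
      using p fin by (auto simp: convex_hull_finite)
    obtain w0 where w0: "\<forall>x\<in>B. 0 \<le> w0 x" "sum w0 B = 1" "(\<Sum>x\<in>B. w0 x *\<^sub>R x) = p"
      using p fin by (auto simp: convex_hull_finite)
    define u where "u x = (if x \<in> A then u0 x else 0)" for x
    define w where "w x = (if x \<in> B then w0 x else 0)" for x
    define U where "U = A \<union> B"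
    have finU: "finite U" using fin by (simp add: U_def)
    have u_nonneg: "u x \<ge> 0" for x using u0 by (simp add: u_def)
    have w_nonneg: "w x \<ge> 0" for x using w0 by (simp add: w_def)
    have u_sum: "sum u U = 1"
      using u0(2) by (subst sum.mono_neutral_right[of U A]) (auto simp: fin U_def u_def)
    have w_sum: "sum w U = 1"
      using w0(2) by (subst sum.mono_neutral_right[of U B]) (auto simp: fin U_def w_def)
    have u_comb: "(\<Sum>x\<in>U. u x *\<^sub>R x) = p"
      using u0(3) by (subst sum.mono_neutral_right[of U A]) (auto simp: fin U_def u_def)
    have w_comb: "(\<Sum>x\<in>U. w x *\<^sub>R x) = p"
      using w0(3) by (subst sum.mono_neutral_right[of U B]) (auto simp: fin U_def w_def)
    define z where "z x = u x - w x" for x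
    define P where "P = {x \<in> U. z x > 0}"
    define N where "N = {x \<in> U. z x < 0}"
    define t where "t = sum z P"
    have PA: "P \<subseteq> A"
    proof
      fix x assume "x \<in> P"
      then have "u x > 0" using w_nonneg[of x] by (simp add: P_def z_def)
      then show "x \<in> A" by (simp add: u_def split: if_splits)
    qed
    have NB: "N \<subseteq> B"
    proof
      fix x assume "x \<in> N"
      then have "w x > 0" using u_nonneg[of x] by (simp add: N_def z_def)
      then show "x \<in> B" by (simp add: w_def split: if_splits)
    qed
    have PN: "P \<inter> N = {}" by (auto simp: P_def N_def)
    have finPN: "finite P" "finite N" using finU by (auto simp: P_def N_def)
    have split_sum: "(\<Sum>x\<in>U. g x) = (\<Sum>x\<in>P. g x) + (\<Sum>x\<in>N. g x)"
      if "\<And>x. z x = 0 \<Longrightarrow> g x = 0" for g :: "'a \<Rightarrow> 'c::comm_monoid_add"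
    proof -
      have "P \<union> N = {x \<in> U. z x \<noteq> 0}" by (auto simp: P_def N_def)
      then have "(\<Sum>x\<in>U. g x) = (\<Sum>x\<in>P \<union> N. g x)"
        by (intro sum.mono_neutral_right) (use finU that in auto)
      then show ?thesis using finPN PN by (simp add: sum.union_disjoint)
    qed
    have "sum z U = 0" using u_sum w_sum by (simp add: z_def sum_subtractf)
    then have tN: "sum z N = - t" using split_sum[of z] by (simp add: t_def)
    have "(\<Sum>x\<in>U. z x *\<^sub>R x) = 0"
      using u_comb w_comb by (simp add: z_def scaleR_left_diff_distrib sum_subtractf)
    then have combN: "(\<Sum>x\<in>P. z x *\<^sub>R x) = - (\<Sum>x\<in>N. z x *\<^sub>R x)"
      using split_sum[of "\<lambda>x. z x *\<^sub>R x"] by (simp add: eq_neg_iff_add_eq_0)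
    have t0: "t = 0"
    proof (rule ccontr)
      assume "t \<noteq> 0"
      moreover have "t \<ge> 0" by (auto simp: t_def P_def intro!: sum_nonneg)
      ultimately have t: "t > 0" by simp
      (* The weights z on P and -z on N have the same total t, so q is a point of both hulls. *)
      define q where "q = (1 / t) *\<^sub>R (\<Sum>x\<in>P. z x *\<^sub>R x)"
      have "q \<in> convex hull P"
        unfolding convex_hull_finite[OF finPN(1)]
        by (intro CollectI exI[of _ "\<lambda>x. z x / t"])
          (use t in \<open>auto simp: q_def scaleR_sum_right P_def t_def
             simp flip: sum_divide_distrib\<close>)
      moreover have "q \<in> convex hull N"
        unfolding convex_hull_finite[OF finPN(2)]
      proof (intro CollectI exI[of _ "\<lambda>x. - z x / t"] conjI ballI)
        show "0 \<le> - z x / t" if "x \<in> N" for x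
          using that t by (auto simp: N_def field_simps)
        show "(\<Sum>x\<in>N. - z x / t) = 1"
          using tN t by (simp add: sum_negf flip: sum_divide_distrib)
        show "(\<Sum>x\<in>N. (- z x / t) *\<^sub>R x) = q"
          by (simp add: q_def combN scaleR_sum_right sum_negf)
      qed
      ultimately show False using disj[OF PA NB PN] by blast
    qed
    have "P = {}"
    proof (rule ccontr)
      assume "P \<noteq> {}"
      then have "sum z P > 0" by (intro sum_pos finPN) (auto simp: P_def)
      then show False using t0 by (simp add: t_def)
    qed
    have "N = {}"
    proof (rule ccontr)
      assume "N \<noteq> {}"
      then have "sum (\<lambda>x. - z x) N > 0" by (intro sum_pos finPN) (auto simp: N_def)
      then show False using t0 tN by (simp add: sum_negf)
    qed
    then have uw: "u x = w x" if "x \<in> U" for x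
      using that \<open>P = {}\<close> by (force simp: P_def N_def z_def)
    have u_zero: "u x = 0" if "x \<in> U - A \<inter> B" for x
      using that uw[of x] by (auto simp: u_def w_def split: if_splits)
    have "sum u (A \<inter> B) = 1"
      using u_sum u_zero by (subst sum.mono_neutral_left[of U]) (auto simp: fin U_def)
    moreover have "(\<Sum>x\<in>A \<inter> B. u x *\<^sub>R x) = p"
      using u_comb u_zero by (subst sum.mono_neutral_left[of U]) (auto simp: fin U_def)
    ultimately show "p \<in> convex hull (A \<inter> B)"
      using fin u_nonneg by (subst convex_hull_finite) auto
  qed
qed

text \<open>
  The vertices of a simplex are its extreme points. So a face of a simplex is the hull of a subset
  of any given system of affinely independent vertices, although the definition of a face chooses
  its own.
\<close>
lemma affine_independent_convex_hull_inject:
  fixes C D :: "'a::euclidean_space set"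
  assumes "\<not> affine_dependent C" "\<not> affine_dependent D" "convex hull C = convex hull D"
  shows "C = D"
  using extreme_point_of_convex_hull_affine_independent[OF assms(1)]
    extreme_point_of_convex_hull_affine_independent[OF assms(2)] assms(3) by auto

lemma simplex_face_convex_hull_iff:
  fixes C :: "'a::euclidean_space set"
  assumes "\<not> affine_dependent C"
  shows "simplex_face F (convex hull C) \<longleftrightarrow> (\<exists>C'\<subseteq>C. C' \<noteq> {} \<and> F = convex hull C')"
  unfolding simplex_face_def using assms affine_independent_convex_hull_inject by metis

section \<open>Meshes\<close>

lemma hull_of_mono: "\<sigma> \<subseteq> \<tau> \<Longrightarrow> hull_of Q \<sigma> \<subseteq> hull_of Q \<tau>"
  unfolding hull_of_def by (intro hull_mono image_mono)

text \<open>
  If two faces without a common vertex meet in an admissible mesh, their intersection is a face of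
  both, so that two different vertices \<open>i\<close> and \<open>j\<close> have the same position. The hull of \<open>{i, j}\<close> is
  then the vertex \<open>Q\<^sub>i\<close>, which makes \<open>{i, j}\<close> a member of the associated complex and hence a face of
  \<open>\<Delta>\<close>; but it is degenerate.
\<close>
lemma disjoint_hulls_if_in_M0:
  fixes Q :: "real ^ 'v::finite ^ 2"
  assumes complex: "abstract_simplicial_complex \<Delta>" and Q: "Q \<in> M0 \<Delta>"
    and faces: "\<sigma> \<in> \<Delta>" "\<tau> \<in> \<Delta>" and disj: "\<sigma> \<inter> \<tau> = {}"
  shows "hull_of Q \<sigma> \<inter> hull_of Q \<tau> = {}"
proof (rule ccontr)
  let ?q = "\<lambda>i. column i Q"
  assume ne: "hull_of Q \<sigma> \<inter> hull_of Q \<tau> \<noteq> {}"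
  have indep: "\<And>\<rho>. \<rho> \<in> \<Delta> \<Longrightarrow> affine_independent_points Q \<rho>"
    and geo: "geometric_simplicial_complex (Sigma_complex \<Delta> Q)"
    and assoc: "associated_complex (Sigma_complex \<Delta> Q) Q = \<Delta>"
    using Q by (auto simp: M0_def)
  have aff: "\<not> affine_dependent (?q ` \<sigma>)" "\<not> affine_dependent (?q ` \<tau>)"
    using indep faces by (auto simp: affine_independent_points_def)
  have "hull_of Q \<sigma> \<in> Sigma_complex \<Delta> Q" "hull_of Q \<tau> \<in> Sigma_complex \<Delta> Q"
    using faces by (auto simp: Sigma_complex_def)
  then have "simplex_face (hull_of Q \<sigma> \<inter> hull_of Q \<tau>) (hull_of Q \<sigma>)"
    "simplex_face (hull_of Q \<sigma> \<inter> hull_of Q \<tau>) (hull_of Q \<tau>)"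
    using geo ne unfolding geometric_simplicial_complex_def by blast+
  then obtain C D where C: "C \<subseteq> ?q ` \<sigma>" "C \<noteq> {}" "hull_of Q \<sigma> \<inter> hull_of Q \<tau> = convex hull C"
    and D: "D \<subseteq> ?q ` \<tau>" "hull_of Q \<sigma> \<inter> hull_of Q \<tau> = convex hull D"
    unfolding hull_of_def simplex_face_convex_hull_iff[OF aff(1)]
      simplex_face_convex_hull_iff[OF aff(2)] by metis
  have "C = D"
  proof (rule affine_independent_convex_hull_inject)
    show "\<not> affine_dependent C" "\<not> affine_dependent D"
      using C D aff affine_independent_subset by blast+
    show "convex hull C = convex hull D" using C D by simp
  qed
  moreover obtain v where "v \<in> C" using C(2) by blast
  ultimately have v: "v \<in> ?q ` \<sigma>" "v \<in> ?q ` \<tau>" using C(1) D(1) by (blast, blast)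
  from v(1) obtain i where i: "i \<in> \<sigma>" "v = ?q i" by (rule imageE)
  from v(2) obtain j where j: "j \<in> \<tau>" "v = ?q j" by (rule imageE)
  have ij: "i \<in> \<sigma>" "j \<in> \<tau>" "?q i = ?q j" using i j by simp_all
  then have "i \<noteq> j" using disj by blast
  have "{i} \<in> \<Delta>"
    using complex faces ij(1) by (auto simp: abstract_simplicial_complex_def)
  moreover have "hull_of Q {i, j} = hull_of Q {i}"
    using ij by (simp add: hull_of_def)
  ultimately have "{i, j} \<in> associated_complex (Sigma_complex \<Delta> Q) Q"
    by (auto simp: associated_complex_def Sigma_complex_def)
  then have "inj_on ?q {i, j}"
    using assoc indep by (auto simp: affine_independent_points_def)
  then show False using ij \<open>i \<noteq> j\<close> by (simp add: inj_on_def)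
qed

text \<open>
  Every vertex is a face, so disjointness of the hulls applied to pairs of vertices makes all
  positions distinct. After that, sets of vertices and sets of their positions correspond, and
  the statements about convex hulls of points transfer to faces.
\<close>
lemma in_M0_if_disjoint_hulls:
  fixes Q :: "real ^ 'v::finite ^ 2"
  assumes complex: "abstract_simplicial_complex \<Delta>" and vertices: "\<Union>\<Delta> = UNIV"
    and disj: "\<And>\<sigma> \<tau>. \<sigma> \<in> \<Delta> \<Longrightarrow> \<tau> \<in> \<Delta> \<Longrightarrow> \<sigma> \<inter> \<tau> = {} \<Longrightarrow> hull_of Q \<sigma> \<inter> hull_of Q \<tau> = {}"
  shows "Q \<in> M0 \<Delta>"
proof -
  let ?q = "\<lambda>i. column i Q"
  have sub: "\<And>\<sigma> \<tau>. \<sigma> \<in> \<Delta> \<Longrightarrow> \<tau> \<subseteq> \<sigma> \<Longrightarrow> \<tau> \<noteq> {} \<Longrightarrow> \<tau> \<in> \<Delta>"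
    and nonempty: "\<Delta> \<noteq> {}" "{} \<notin> \<Delta>"
    using complex unfolding abstract_simplicial_complex_def by blast+
  have vertex: "{i} \<in> \<Delta>" for i
  proof -
    have "i \<in> \<Union>\<Delta>" by (simp add: vertices)
    then obtain \<sigma> where "i \<in> \<sigma>" "\<sigma> \<in> \<Delta>" by (rule UnionE)
    then show ?thesis using sub[of \<sigma> "{i}"] by simp
  qed
  have inj: "inj ?q"
  proof (rule injI, rule ccontr)
    fix i j assume "?q i = ?q j" "i \<noteq> j"
    then show False using disj[OF vertex vertex, of i j] by (simp add: hull_of_def)
  qed
  have disj': "hull_of Q \<sigma>' \<inter> hull_of Q \<tau>' = {}"
    if "\<sigma> \<in> \<Delta>" "\<tau> \<in> \<Delta>" "\<sigma>' \<subseteq> \<sigma>" "\<tau>' \<subseteq> \<tau>" "\<sigma>' \<inter> \<tau>' = {}" for \<sigma> \<tau> \<sigma>' \<tau>'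
  proof (cases "\<sigma>' = {} \<or> \<tau>' = {}")
    case True
    then show ?thesis by (auto simp: hull_of_def)
  next
    case False
    then have "\<sigma>' \<in> \<Delta>" "\<tau>' \<in> \<Delta>" using sub that by auto
    then show ?thesis using disj that(5) by simp
  qed
  have disj_points: "convex hull A \<inter> convex hull B = {}"
    if AB: "\<sigma> \<in> \<Delta>" "\<tau> \<in> \<Delta>" "A \<subseteq> ?q ` \<sigma>" "B \<subseteq> ?q ` \<tau>" "A \<inter> B = {}" for \<sigma> \<tau> A B
  proof -
    obtain \<sigma>' where \<sigma>': "\<sigma>' \<subseteq> \<sigma>" "A = ?q ` \<sigma>'" using AB(3) by (rule subset_imageE)
    obtain \<tau>' where \<tau>': "\<tau>' \<subseteq> \<tau>" "B = ?q ` \<tau>'" using AB(4) by (rule subset_imageE)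
    have "\<sigma>' \<inter> \<tau>' = {}" using \<sigma>' \<tau>' AB(5) by auto
    then show ?thesis using disj'[OF AB(1,2) \<sigma>'(1) \<tau>'(1)] \<sigma>' \<tau>' by (simp add: hull_of_def)
  qed
  have aff: "\<not> affine_dependent (?q ` \<sigma>)" if "\<sigma> \<in> \<Delta>" for \<sigma>
  proof
    assume "affine_dependent (?q ` \<sigma>)"
    then obtain A B where "A \<inter> B = {}" "A \<union> B = ?q ` \<sigma>" "convex hull A \<inter> convex hull B \<noteq> {}"
      using Radon_partition[of "?q ` \<sigma>"] by auto
    then show False using disj_points[OF that that, of A B] by blast
  qed
  have Int: "hull_of Q \<sigma> \<inter> hull_of Q \<tau> = hull_of Q (\<sigma> \<inter> \<tau>)" if "\<sigma> \<in> \<Delta>" "\<tau> \<in> \<Delta>" for \<sigma> \<tau>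
    using disj_points[OF that] unfolding hull_of_def image_Int[OF inj]
    by (intro convex_hull_Int_if_disjoint_subsets) auto
  have face: "simplex_face F (hull_of Q \<sigma>) \<longleftrightarrow> (\<exists>\<sigma>'\<subseteq>\<sigma>. \<sigma>' \<noteq> {} \<and> F = hull_of Q \<sigma>')"
    if "\<sigma> \<in> \<Delta>" for F \<sigma>
    unfolding hull_of_def simplex_face_convex_hull_iff[OF aff[OF that]]
    by (auto simp: subset_image_iff)
  have "geometric_simplicial_complex (Sigma_complex \<Delta> Q)"
    unfolding geometric_simplicial_complex_def
  proof (intro conjI ballI allI impI)
    show "Sigma_complex \<Delta> Q \<noteq> {}" "finite (Sigma_complex \<Delta> Q)"
      using nonempty by (auto simp: Sigma_complex_def)
  next
    fix S assume "S \<in> Sigma_complex \<Delta> Q"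
    then obtain \<sigma> where \<sigma>: "\<sigma> \<in> \<Delta>" "S = hull_of Q \<sigma>" by (auto simp: Sigma_complex_def)
    have "card (?q ` \<sigma>) > 0" using \<sigma> nonempty by (auto simp: card_gt_0_iff)
    then have "int (card (?q ` \<sigma>)) = int (card (?q ` \<sigma>) - 1) + 1" by simp
    then show "\<exists>k. int k simplex S"
      unfolding simplex_def \<sigma>(2) hull_of_def using aff[OF \<sigma>(1)] by blast
    fix F assume "simplex_face F S"
    then obtain \<sigma>' where "\<sigma>' \<subseteq> \<sigma>" "\<sigma>' \<noteq> {}" "F = hull_of Q \<sigma>'"
      using face[OF \<sigma>(1)] \<sigma>(2) by auto
    then show "F \<in> Sigma_complex \<Delta> Q"
      using sub[OF \<sigma>(1)] by (auto simp: Sigma_complex_def)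
  next
    fix S T assume "S \<in> Sigma_complex \<Delta> Q" "T \<in> Sigma_complex \<Delta> Q" and ne: "S \<inter> T \<noteq> {}"
    then obtain \<sigma> \<tau> where \<sigma>\<tau>: "\<sigma> \<in> \<Delta>" "S = hull_of Q \<sigma>" "\<tau> \<in> \<Delta>" "T = hull_of Q \<tau>"
      by (auto simp: Sigma_complex_def)
    then have "S \<inter> T = hull_of Q (\<sigma> \<inter> \<tau>)" "\<sigma> \<inter> \<tau> \<noteq> {}"
      using Int[of \<sigma> \<tau>] disj[of \<sigma> \<tau>] ne by auto
    then show "simplex_face (S \<inter> T) S" "simplex_face (S \<inter> T) T"
      unfolding \<sigma>\<tau>(2,4) face[OF \<sigma>\<tau>(1)] face[OF \<sigma>\<tau>(3)] by (blast, blast)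
  qed
  moreover have "associated_complex (Sigma_complex \<Delta> Q) Q = \<Delta>"
  proof
    show "\<Delta> \<subseteq> associated_complex (Sigma_complex \<Delta> Q) Q"
      by (auto simp: associated_complex_def Sigma_complex_def)
    show "associated_complex (Sigma_complex \<Delta> Q) Q \<subseteq> \<Delta>"
    proof
      fix \<sigma> assume "\<sigma> \<in> associated_complex (Sigma_complex \<Delta> Q) Q"
      then obtain \<tau> where \<tau>: "\<tau> \<in> \<Delta>" "hull_of Q \<sigma> = hull_of Q \<tau>"
        by (auto simp: associated_complex_def Sigma_complex_def)
      (* A vertex of \<sigma> outside \<tau> would be a face that is disjoint from \<tau> but lies in its hull. *)
      have "\<sigma> \<subseteq> \<tau>"
      proof (rule ccontr)
        assume "\<not> \<sigma> \<subseteq> \<tau>"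
        then obtain i where i: "i \<in> \<sigma>" "i \<notin> \<tau>" by blast
        have "hull_of Q {i} \<subseteq> hull_of Q \<tau>"
          using hull_of_mono[of "{i}" \<sigma> Q] i \<tau> by simp
        moreover have "hull_of Q {i} \<noteq> {}" by (simp add: hull_of_def)
        ultimately show False using disj[OF vertex \<tau>(1), of i] i by auto
      qed
      moreover have "\<sigma> \<noteq> {}"
        using \<tau> nonempty by (metis convex_hull_eq_empty hull_of_def image_is_empty)
      ultimately show "\<sigma> \<in> \<Delta>" using sub \<tau> by blast
    qed
  qed
  ultimately show ?thesis
    using aff inj_on_subset[OF inj] by (auto simp: M0_def affine_independent_points_def)
qed

lemma M0_eq_disjoint_hulls:
  fixes \<Delta> :: "'v::finite set set"
  assumes "abstract_simplicial_complex \<Delta>" "\<Union>\<Delta> = UNIV"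
  shows "M0 \<Delta> = (\<Inter>\<sigma>\<in>\<Delta>. \<Inter>\<tau>\<in>{\<tau>\<in>\<Delta>. \<sigma> \<inter> \<tau> = {}}. {Q. hull_of Q \<sigma> \<inter> hull_of Q \<tau> = {}})"
  using disjoint_hulls_if_in_M0[OF assms(1)] in_M0_if_disjoint_hulls[OF assms] by auto

text \<open>
  A strictly separating line for the mesh \<open>Q\<close> defines the open neighbourhood of \<open>Q\<close> in which all
  vertices stay on their side of that line.
\<close>
lemma open_disjoint_hulls:
  fixes \<sigma> \<tau> :: "'v::finite set"
  shows "open {Q. hull_of Q \<sigma> \<inter> hull_of Q \<tau> = {}}"
proof (cases "\<tau> = {}")
  case True
  then show ?thesis by (simp add: hull_of_def)
next
  case False
  show ?thesis
  proof (subst open_subopen, intro ballI)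
    fix Q :: "real ^ 'v ^ 2"
    assume "Q \<in> {Q. hull_of Q \<sigma> \<inter> hull_of Q \<tau> = {}}"
    then have "hull_of Q \<sigma> \<inter> hull_of Q \<tau> = {}" by simp
    moreover have "convex (hull_of Q \<rho>)" "compact (hull_of Q \<rho>)" for \<rho>
      by (auto simp: hull_of_def intro: finite_imp_compact_convex_hull)
    moreover have "hull_of Q \<tau> \<noteq> {}" using False by (simp add: hull_of_def)
    ultimately obtain a b
      where ab: "\<forall>x\<in>hull_of Q \<sigma>. a \<bullet> x < b" "\<forall>x\<in>hull_of Q \<tau>. a \<bullet> x > b"
      using separating_hyperplane_closed_compact[of "hull_of Q \<sigma>" "hull_of Q \<tau>"]
        compact_imp_closed by blast
    define T :: "(real ^ 'v ^ 2) set"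
      where "T = (\<Inter>i\<in>\<sigma>. {R. a \<bullet> column i R < b}) \<inter> (\<Inter>j\<in>\<tau>. {R. a \<bullet> column j R > b})"
    have "continuous_on UNIV (\<lambda>R :: real ^ 'v ^ 2. a \<bullet> column i R)" for i
      unfolding column_def by (intro continuous_intros)
    then have "open T"
      unfolding T_def
      by (intro open_Int open_INT ballI finite open_Collect_less continuous_on_const)
    moreover have "Q \<in> T"
      using ab by (auto simp: T_def hull_of_def hull_inc)
    moreover have "hull_of R \<sigma> \<inter> hull_of R \<tau> = {}" if "R \<in> T" for R
    proof -
      have "hull_of R \<sigma> \<subseteq> {x. a \<bullet> x < b}" "hull_of R \<tau> \<subseteq> {x. a \<bullet> x > b}"
        unfolding hull_of_def
        by (intro hull_minimal convex_halfspace_lt convex_halfspace_gt;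
            use that in \<open>auto simp: T_def\<close>)+
      then show ?thesis by force
    qed
    ultimately show "\<exists>T. open T \<and> Q \<in> T \<and> T \<subseteq> {Q. hull_of Q \<sigma> \<inter> hull_of Q \<tau> = {}}"
      by blast
  qed
qed

section \<open>Openness of the set of admissible meshes\<close>

theorem proposition3p4:
  fixes \<Delta> :: "'v::finite set set"
  assumes "connectivity_complex \<Delta>"
    and "vertex_set \<Delta> = UNIV"
  shows "open (M0 \<Delta>)"
proof -
  have "abstract_simplicial_complex \<Delta>" "\<Union>\<Delta> = UNIV"
    using assms
    by (simp_all add: connectivity_complex_def simplicial_2_complex_def vertex_set_def)
  then show ?thesis
    unfolding M0_eq_disjoint_hulls[OF \<open>abstract_simplicial_complex \<Delta>\<close> \<open>\<Union>\<Delta> = UNIV\<close>]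
    by (intro open_INT ballI finite open_disjoint_hulls)
qed

end
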